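(* Let $X$ be a normed space, let $\mathcal{I}$ be an ideal on $\mathbb{N}$, let $\{\omega_t\}_{t\in\mathbb{N}}$ be a weighted sequence, and let $x=\{x_t\}_{t\in\mathbb{N}}$ be a sequence contained in some totally bounded subset of $X$. Then the interior of $(\omega_t,\mathcal{I})\text{-}\mathrm{LIM}^{\tilde r(x)} x_t$ in $X$ is empty.
   Context: A sequence $\{\omega_t\}_{t\in\mathbb{N}}$ of real numbers is a weighted sequence if there is $\beta>0$ with $\omega_t>\beta$ for all $t\in\mathbb{N}$. An ideal on $\mathbb{N}$ is a family $\mathcal{I}\subseteq\mathcal{P}(\mathbb{N})$ with $\varnothing\in\mathcal{I}$, closed under finite unions and under taking subsets. For $r\ge0$, $(\omega_t,\mathcal{I})\text{-}\mathrm{LIM}^r x_t$ is the set of all $x_*\in X$ such that $\{t\in\mathbb{N}:\omega_t\|x_t-x_*\|>r+\varepsilon\}\in\mathcal{I}$ for every $\varepsilon>0$. The minimal weighted ideal convergent degree of $x$ is $\tilde r(x)=\tilde r_{(\omega_t,\mathcal{I})}(x):=\inf\{r\in(0,\infty):(\omega_t,\mathcal{I})\text{-}\mathrm{LIM}^r x_t\ne\varnothing\}$.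
   Formalization: The normed space X is assumed nonzero and the ideal is assumed proper (ℕ is not in it); if X = {0} or the ideal is all of P(ℕ), the minimal degree is 0 and the limit set is all of X, so its interior is not empty. *)

theory Defs
  imports "HOL-Analysis.Analysis"
begin

definition weighted_seq :: "(nat \<Rightarrow> real) \<Rightarrow> bool" where
  "weighted_seq \<omega> \<longleftrightarrow> (\<exists>\<beta>>0. \<forall>t. \<omega> t > \<beta>)"

(* Properness (UNIV not in the family) and admissibility are not part of the notion. *)
definition nat_ideal :: "nat set set \<Rightarrow> bool" where
  "nat_ideal \<I> \<longleftrightarrow>
     {} \<in> \<I> \<and> (\<forall>A\<in>\<I>. \<forall>B\<in>\<I>. A \<union> B \<in> \<I>) \<and> (\<forall>A\<in>\<I>. \<forall>B. B \<subseteq> A \<longrightarrow> B \<in> \<I>)"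

definition rough_LIM ::
  "(nat \<Rightarrow> real) \<Rightarrow> nat set set \<Rightarrow> real \<Rightarrow> (nat \<Rightarrow> 'a::real_normed_vector) \<Rightarrow> 'a set" where
  "rough_LIM \<omega> \<I> r x = {a. \<forall>\<epsilon>>0. {t. \<omega> t * norm (x t - a) > r + \<epsilon>} \<in> \<I>}"

(* The infimum is taken in the reals. If no r > 0 has a nonempty limit set (mathematically, the
   degree is infinite), its value is an unspecified real. As rough_LIM increases with r for an
   ideal, rough_LIM is then empty for every real r, in particular at that value. *)
definition min_conv_degree ::
  "(nat \<Rightarrow> real) \<Rightarrow> nat set set \<Rightarrow> (nat \<Rightarrow> 'a::real_normed_vector) \<Rightarrow> real" where
  "min_conv_degree \<omega> \<I> x = Inf {r. 0 < r \<and> rough_LIM \<omega> \<I> r x \<noteq> {}}"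

end

theory Submission
  imports Defs
begin

text \<open>A ball inside the limit set leaves room to lower the degree at its centre. Suppose every
  point at distance \<open>d\<close> from \<open>a\<close> lies in the limit set of degree \<open>r\<close>. Seen from a term \<open>x t\<close>, the
  point \<open>y\<close> at distance \<open>d\<close> from \<open>a\<close> diametrically behind \<open>a\<close> is farther away than \<open>a\<close> by exactly
  \<open>d\<close>; so the bound \<open>r\<close> on the weighted distance to \<open>y\<close> becomes a bound \<open>r - \<omega> t * d\<close> on the one to
  \<open>a\<close>, and \<open>\<omega> t\<close> is bounded away from \<open>0\<close>.

  The point \<open>y\<close> depends on \<open>t\<close>, whereas membership in the limit set concerns one point at a time
  and an ideal is closed under finite unions only. Total boundedness resolves this: replacing
  \<open>x t\<close> by a nearby point of a finite net, finitely many points \<open>y\<close> suffice, at the price of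
  lowering the degree a little less (lemma \<open>rough_LIM_centre\<close>). The limit set of some degree
  strictly below the minimal one is then nonempty. This contradicts minimality if that degree is
  nonnegative, and if it is negative then properness of the ideal forbids it.\<close>

lemma nat_ideal_subset: "nat_ideal \<I> \<Longrightarrow> A \<in> \<I> \<Longrightarrow> B \<subseteq> A \<Longrightarrow> B \<in> \<I>"
  unfolding nat_ideal_def by blast

lemma nat_ideal_finite_UN:
  assumes "nat_ideal \<I>" "finite K" "\<And>z. z \<in> K \<Longrightarrow> F z \<in> \<I>"
  shows "(\<Union>z\<in>K. F z) \<in> \<I>"
  using assms(2,3)
proof (induction K rule: finite_induct)
  case empty
  then show ?case using assms(1) by (simp add: nat_ideal_def)
next
  case (insert z K)
  then show ?case using assms(1) by (simp add: nat_ideal_def)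
qed

lemma rough_LIM_mono:
  assumes "nat_ideal \<I>" "r \<le> s"
  shows "rough_LIM \<omega> \<I> r x \<subseteq> rough_LIM \<omega> \<I> s x"
proof
  fix a assume a: "a \<in> rough_LIM \<omega> \<I> r x"
  have "{t. \<omega> t * norm (x t - a) > s + \<epsilon>} \<in> \<I>" if "\<epsilon> > 0" for \<epsilon>
  proof (rule nat_ideal_subset[OF assms(1)])
    show "{t. \<omega> t * norm (x t - a) > r + \<epsilon>} \<in> \<I>"
      using a that by (simp add: rough_LIM_def)
  qed (use assms(2) in auto)
  then show "a \<in> rough_LIM \<omega> \<I> s x" by (simp add: rough_LIM_def)
qed

lemma rough_LIM_negative_empty:
  assumes "UNIV \<notin> \<I>" "\<And>t. \<omega> t \<ge> 0" "r < 0"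
  shows "rough_LIM \<omega> \<I> r x = {}"
proof (rule equals0I)
  fix a assume "a \<in> rough_LIM \<omega> \<I> r x"
  then have "{t. \<omega> t * norm (x t - a) > r + (- r / 2)} \<in> \<I>"
    using assms(3) unfolding rough_LIM_def by (auto dest: spec[of _ "- r / 2"])
  moreover have "\<omega> t * norm (x t - a) > r + (- r / 2)" for t
  proof -
    have "0 \<le> \<omega> t * norm (x t - a)" using assms(2) by simp
    then show ?thesis using assms(3) by linarith
  qed
  ultimately show False using assms(1) by simp
qed

text \<open>The point is found by prolonging the segment from \<open>z\<close> to \<open>a\<close> beyond \<open>a\<close> by length \<open>d\<close>. When
  \<open>z = a\<close> any direction serves, provided that the space has one.\<close>

lemma exists_point_behind:
  fixes a z :: "'a::real_normed_vector"
  assumes "\<exists>v::'a. v \<noteq> 0" "0 \<le> d"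
  obtains y where "dist a y = d" "dist z y = dist z a + d"
proof -
  obtain u :: 'a where u: "norm u = 1" "a - z = norm (a - z) *\<^sub>R u"
  proof (cases "a = z")
    case True
    obtain v :: 'a where "v \<noteq> 0" using assms(1) by blast
    then show thesis using that[of "sgn v"] True by (simp add: norm_sgn)
  next
    case False
    then show thesis using that[of "sgn (a - z)"] by (simp add: norm_sgn sgn_div_norm)
  qed
  have "a + d *\<^sub>R u - z = (norm (a - z) + d) *\<^sub>R u"
    using u(2) by (simp add: algebra_simps)
  then have "norm (a + d *\<^sub>R u - z) = norm (a - z) + d"
    using u(1) assms(2) by simp
  then show thesis
    using that[of "a + d *\<^sub>R u"] u(1) assms(2) by (simp add: dist_norm norm_minus_commute)
qed

text \<open>The quantitative core: the degree drops by \<open>\<beta> * c\<close> at the centre of a ball of radius \<open>d\<close>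
  contained in the limit set. The gap between \<open>c\<close> and \<open>d\<close> pays for approximating the terms by a
  finite net.\<close>

lemma rough_LIM_centre:
  fixes x :: "nat \<Rightarrow> 'a::real_normed_vector"
  assumes space: "\<exists>v::'a. v \<noteq> 0"
    and ideal: "nat_ideal \<I>"
    and weights: "0 \<le> \<beta>" "\<And>t. \<beta> \<le> \<omega> t"
    and tb: "totally_bounded S" "range x \<subseteq> S"
    and ball: "cball a d \<subseteq> rough_LIM \<omega> \<I> r x"
    and c: "0 \<le> c" "c < d"
  shows "a \<in> rough_LIM \<omega> \<I> (r - \<beta> * c) x"
proof -
  \<comment> \<open>The net is used twice, to pass from \<open>x t\<close> to a net point and back, hence mesh \<open>(d - c) / 2\<close>.\<close>
  define \<eta> where "\<eta> = (d - c) / 2"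
  have "\<eta> > 0" using c by (simp add: \<eta>_def)
  then obtain K where K: "finite K" "S \<subseteq> (\<Union>z\<in>K. {y. dist z y < \<eta>})"
    using tb(1) unfolding totally_bounded_metric by blast
  have "\<exists>y. dist a y = d \<and> dist z y = dist z a + d" for z
    using exists_point_behind[OF space, of d a z] c by auto
  then obtain Y where Y: "\<And>z. dist a (Y z) = d" "\<And>z. dist z (Y z) = dist z a + d"
    by metis
  have "{t. \<omega> t * norm (x t - a) > r - \<beta> * c + \<epsilon>} \<in> \<I>" if "\<epsilon> > 0" for \<epsilon>
  proof (rule nat_ideal_subset[OF ideal])
    show "(\<Union>z\<in>K. {t. \<omega> t * norm (x t - Y z) > r + \<epsilon>}) \<in> \<I>"
    proof (rule nat_ideal_finite_UN[OF ideal K(1)])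
      fix z
      have "Y z \<in> rough_LIM \<omega> \<I> r x" using ball Y(1) by auto
      then show "{t. \<omega> t * norm (x t - Y z) > r + \<epsilon>} \<in> \<I>"
        using that by (simp add: rough_LIM_def)
    qed
    show "{t. \<omega> t * norm (x t - a) > r - \<beta> * c + \<epsilon>}
            \<subseteq> (\<Union>z\<in>K. {t. \<omega> t * norm (x t - Y z) > r + \<epsilon>})"
    proof
      fix t assume "t \<in> {t. \<omega> t * norm (x t - a) > r - \<beta> * c + \<epsilon>}"
      then have t: "\<omega> t * dist (x t) a > r - \<beta> * c + \<epsilon>" by (simp add: dist_norm)
      obtain z where z: "z \<in> K" "dist z (x t) < \<eta>" using K(2) tb(2) by blast
      have "dist z (Y z) \<le> dist z (x t) + dist (x t) (Y z)"
        "dist (x t) a \<le> dist z (x t) + dist z a"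
        by (rule dist_triangle dist_triangle3)+
      then have "dist (x t) a + c \<le> dist (x t) (Y z)"
        using Y(2)[of z] z(2) by (simp add: \<eta>_def field_simps)
      moreover have "0 \<le> \<omega> t" using weights(1) weights(2)[of t] by linarith
      ultimately have "\<omega> t * (dist (x t) a + c) \<le> \<omega> t * dist (x t) (Y z)"
        by (rule mult_left_mono)
      moreover have "\<beta> * c \<le> \<omega> t * c" using weights(2) c(1) by (rule mult_right_mono)
      ultimately have "\<omega> t * dist (x t) (Y z) > r + \<epsilon>"
        using t by (simp add: distrib_left)
      then show "t \<in> (\<Union>z\<in>K. {t. \<omega> t * norm (x t - Y z) > r + \<epsilon>})"
        using z(1) by (auto simp: dist_norm)
    qed
  qed
  then show ?thesis by (simp add: rough_LIM_def)
qed

theorem proposition3p3: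
  fixes x :: "nat \<Rightarrow> 'a::real_normed_vector"
    and \<omega> :: "nat \<Rightarrow> real"
    and \<I> :: "nat set set"
  assumes nontrivial_space: "\<exists>v::'a. v \<noteq> 0"
    and ideal: "nat_ideal \<I>"
    and proper: "UNIV \<notin> \<I>"
    and weighted: "weighted_seq \<omega>"
    and totally_bounded_range: "\<exists>S. totally_bounded S \<and> range x \<subseteq> S"
  shows "interior (rough_LIM \<omega> \<I> (min_conv_degree \<omega> \<I> x) x) = {}"
proof (rule equals0I)
  define r where "r = min_conv_degree \<omega> \<I> x"
  fix a assume "a \<in> interior (rough_LIM \<omega> \<I> (min_conv_degree \<omega> \<I> x) x)"
  then obtain d where d: "d > 0" "cball a d \<subseteq> rough_LIM \<omega> \<I> r x"
    unfolding r_def mem_interior_cball by blast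
  obtain \<beta> where \<beta>: "\<beta> > 0" "\<And>t. \<beta> < \<omega> t"
    using weighted unfolding weighted_seq_def by blast
  obtain S where S: "totally_bounded S" "range x \<subseteq> S"
    using totally_bounded_range by blast
  define q where "q = r - \<beta> * (d / 2)"
  have aq: "a \<in> rough_LIM \<omega> \<I> q x"
    unfolding q_def
    by (rule rough_LIM_centre[OF nontrivial_space ideal _ _ S d(2)])
      (use \<beta> d(1) in \<open>simp_all add: less_imp_le\<close>)
  have "q < r" using \<beta>(1) d(1) by (simp add: q_def)
  have nonneg: "0 \<le> \<omega> t" for t using \<beta>(1) \<beta>(2)[of t] by linarith
  have "\<not> q < 0" using rough_LIM_negative_empty[where \<omega> = \<omega>, OF proper nonneg] aq by blast
  then have "0 \<le> q" by simp
  \<comment> \<open>The infimum ranges over positive degrees only and \<open>q\<close> may be \<open>0\<close>, so a degree strictly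
    between \<open>q\<close> and \<open>r\<close> serves as the witness against minimality.\<close>
  define s where "s = (q + r) / 2"
  have s: "0 < s" "q \<le> s" "s < r" using \<open>q < r\<close> \<open>0 \<le> q\<close> by (simp_all add: s_def)
  then have "rough_LIM \<omega> \<I> s x \<noteq> {}" using rough_LIM_mono[OF ideal s(2)] aq by blast
  then have "r \<le> s"
    unfolding r_def min_conv_degree_def using s(1)
    by (intro cInf_lower bdd_belowI[of _ 0]) auto
  then show False using s(3) by simp
qed

end
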